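(* For each integer $N\ge 2$ let $(c^{(N)}(x,x+1))_{1\le x<N}$ be strictly positive numbers, set $r^{(N)}(x,x+1)=1/c^{(N)}(x,x+1)$ and $r^{(N)}(n,m)=\sum_{x=n}^{m-1} r^{(N)}(x,x+1)$ for $1\le n<m\le N$, and assume $$\limsup_{N\to\infty}\ \frac1N\ \sup_{1\le n<m\le N}\left| r^{(N)}(n,m)-(m-n)\right| = 0 .$$ Let $\mathrm{gap}_N$ be the spectral gap of $\Delta^{(c)}$ (the minimal strictly positive eigenvalue of $-\Delta^{(c)}$), and let $g_1=g_1^{(N)}$ be the eigenfunction with $\Delta^{(c)}g_1=-\mathrm{gap}_N\, g_1$ and $g_1(1)=1$. Let $h(x)=h_N(x)=\cos\left(\frac{\pi(x-1/2)}{N}\right)$ for $x\in\{1,\dots,N\}$. Then $$\lim_{N\to\infty}\frac{N^2\,\mathrm{gap}_N}{\pi^2}=1,$$ $$\lim_{N\to\infty}\ \sup_{1\le x\le N}\ |g_1(x)-h(x)|=0,$$ $$\lim_{N\to\infty}\ \sup_{1\le x\le N}\ \left|N(c\nabla g_1)(x)-N(\nabla h)(x)\right|=0 .$$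
   Context: For $f:\{1,\dots,N\}\to\mathbb R$, set $(c\nabla f)(x)=c^{(N)}(x-1,x)[f(x)-f(x-1)]$ for $2\le x\le N$, with the convention (Neumann boundary conditions) $(c\nabla f)(1)=(c\nabla f)(N+1)=0$. The generator is $(\Delta^{(c)}f)(x)=(c\nabla f)(x+1)-(c\nabla f)(x)$ for $1\le x\le N$. $(\nabla f)$ denotes the same expression with all conductances equal to $1$, i.e. $(\nabla h)(x)=h(x)-h(x-1)$ for $2\le x\le N$ and $(\nabla h)(1)=0$. The operator $\Delta^{(c)}$ is self-adjoint with respect to the uniform measure on $\{1,\dots,N\}$; $-\Delta^{(c)}$ has simple eigenvalues, and no eigenfunction vanishes at $1$, so $g_1$ is well defined. *)

theory Defs
  imports "HOL-Analysis.Analysis"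
begin

text \<open>
  A function on \<open>{1, ..., N}\<close> is a function on \<^typ>\<open>nat\<close> of which only the values on
  \<open>{1..N}\<close> matter. Conductances are indexed by the left end of the edge: \<open>c x\<close> is the
  conductance of the edge between \<open>x\<close> and \<open>x + 1\<close>, for \<open>1 \<le> x < N\<close>.
\<close>

text \<open>The gradient, vanishing at \<open>1\<close> and \<open>N + 1\<close> (Neumann boundary conditions).\<close>

definition cgrad :: "nat \<Rightarrow> (nat \<Rightarrow> real) \<Rightarrow> (nat \<Rightarrow> real) \<Rightarrow> nat \<Rightarrow> real" where
  "cgrad N c f x = (if 2 \<le> x \<and> x \<le> N then c (x - 1) * (f x - f (x - 1)) else 0)"

definition generator :: "nat \<Rightarrow> (nat \<Rightarrow> real) \<Rightarrow> (nat \<Rightarrow> real) \<Rightarrow> nat \<Rightarrow> real" where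
  "generator N c f x = cgrad N c f (x + 1) - cgrad N c f x"

definition resistance :: "(nat \<Rightarrow> real) \<Rightarrow> nat \<Rightarrow> nat \<Rightarrow> real" where
  "resistance c n m = (\<Sum>x = n..<m. 1 / c x)"

definition is_eigenvalue_neg_generator :: "nat \<Rightarrow> (nat \<Rightarrow> real) \<Rightarrow> real \<Rightarrow> bool" where
  "is_eigenvalue_neg_generator N c l \<longleftrightarrow>
     (\<exists>f. (\<exists>x\<in>{1..N}. f x \<noteq> 0) \<and> (\<forall>x\<in>{1..N}. - generator N c f x = l * f x))"

definition spectral_gap :: "nat \<Rightarrow> (nat \<Rightarrow> real) \<Rightarrow> real" where
  "spectral_gap N c = (LEAST l. 0 < l \<and> is_eigenvalue_neg_generator N c l)"

text \<open>
  Membership in \<^term>\<open>extensional {1..N}\<close> fixes the irrelevant values outside \<open>{1..N}\<close>, so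
  that the description is definite.
\<close>

definition gap_eigenfunction :: "nat \<Rightarrow> (nat \<Rightarrow> real) \<Rightarrow> nat \<Rightarrow> real" where
  "gap_eigenfunction N c =
     (THE g. g \<in> extensional {1..N} \<and>
             (\<forall>x\<in>{1..N}. generator N c g x = - spectral_gap N c * g x) \<and> g 1 = 1)"

definition cos_profile :: "nat \<Rightarrow> nat \<Rightarrow> real" where
  "cos_profile N x = cos (pi * (real x - 1/2) / real N)"

end

theory Submission
  imports Defs "HOL-Real_Asymp.Real_Asymp"
begin

text \<open>
  Solve the eigenvalue equation for the eigenvalue \<open>l\<close> from the left end with \<open>g(1) = 1\<close>.
  Summing by parts twice, the solution satisfies the discrete Volterra equation
  \<open>g(x) = 1 - l \<Sum>\<^bsub>z<x\<^esub> r(z, x) g(z)\<close>, which involves the conductances only through the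
  resistances \<open>r(z, x)\<close>, and \<open>l \<noteq> 0\<close> is an eigenvalue iff \<open>\<Sum>\<^bsub>z\<le>N\<^esub> g(z) = 0\<close>.
  For unit conductances and \<open>l = 4 sin\<^sup>2(s / 2N)\<close> the corresponding solution is a multiple of
  \<open>cos(s (x - 1/2) / N)\<close>, whose sum over \<open>{1..N}\<close> is \<open>sin s / (2 sin(s / 2N))\<close>. Replacing
  \<open>r(z, x)\<close> by \<open>x - z\<close> costs \<open>o(N)\<close>, so by a discrete Gronwall inequality \<open>g\<close> is uniformly close
  to the cosine for bounded \<open>s\<close>. Hence the sum of \<open>g\<close> has no zero for \<open>0 < s \<le> \<pi> - \<delta>\<close> and
  changes sign before \<open>\<pi> + \<delta>\<close>; this locates the gap, and the flux of the eigenfunction is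
  \<open>- l\<close> times a partial sum of \<open>g\<close>.
\<close>

section \<open>The solution from the left end and its Volterra equation\<close>

lemma resistance_Suc:
  "z \<le> x \<Longrightarrow> resistance c z (Suc x) = resistance c z x + 1 / c x"
  by (simp add: resistance_def)

lemma resistance_self [simp]: "resistance c x x = 0"
  by (simp add: resistance_def)

text \<open>The Volterra equation itself serves as the recursion: only values at
  \<open>z < x\<close> occur on the right, and continuity in \<open>l\<close> and stability in the
  resistances can be read off from it. Neither \<open>N\<close> nor the right boundary condition
  enters.\<close>

function shoot :: "(nat \<Rightarrow> real) \<Rightarrow> real \<Rightarrow> nat \<Rightarrow> real" where
  "shoot c l x = 1 - l * (\<Sum>z\<in>{1..<x}. resistance c z x * shoot c l z)"
  by auto
termination by (relation "Wellfounded.measure (\<lambda>(c, l, x). x)") auto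

declare shoot.simps [simp del]

lemma shoot_1 [simp]: "shoot c l (Suc 0) = 1"
  by (subst shoot.simps) simp

lemma continuous_on_shoot: "continuous_on S (\<lambda>l. shoot c l x)"
proof (induction x rule: less_induct)
  case (less x)
  have eq: "(\<lambda>l. shoot c l x) = (\<lambda>l. 1 - l * (\<Sum>z\<in>{1..<x}. resistance c z x * shoot c l z))"
    by (rule ext) (rule shoot.simps)
  show ?case
    unfolding eq using less by (intro continuous_intros) auto
qed

text \<open>Passing from \<open>x\<close> to \<open>Suc x\<close> adds \<open>1 / c x\<close> to
  every resistance; the new summand \<open>z = x\<close> consists of this increment alone because
  \<open>resistance c x x = 0\<close>.\<close>

lemma volterra_sum_Suc:
  assumes "1 \<le> x"
  shows "(\<Sum>z\<in>{1..<Suc x}. resistance c z (Suc x) * f z)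
    = (\<Sum>z\<in>{1..<x}. resistance c z x * f z) + (\<Sum>z=1..x. f z) / c x"
proof -
  have "(\<Sum>z\<in>{1..<Suc x}. resistance c z (Suc x) * f z)
      = (\<Sum>z=1..x. resistance c z x * f z + f z / c x)"
    using assms by (intro sum.cong) (auto simp: resistance_Suc algebra_simps)
  also have "\<dots> = (\<Sum>z=1..x. resistance c z x * f z) + (\<Sum>z=1..x. f z) / c x"
    by (simp add: sum.distrib sum_divide_distrib)
  also have "(\<Sum>z=1..x. resistance c z x * f z) = (\<Sum>z\<in>{1..<x}. resistance c z x * f z)"
    using assms by (intro sum.mono_neutral_right) auto
  finally show ?thesis .
qed

text \<open>This is the second summation by parts. It is kept free of \<open>shoot\<close> because
  it is applied to arbitrary eigenfunctions and, with unit conductances, to the cosine.\<close>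

lemma volterra_of_differences:
  assumes diff: "\<And>x. 1 \<le> x \<Longrightarrow> x < N \<Longrightarrow> f (Suc x) - f x = - l * (\<Sum>z=1..x. f z) / c x"
    and "1 \<le> x" "x \<le> N"
  shows "f x = f 1 - l * (\<Sum>z\<in>{1..<x}. resistance c z x * f z)"
  using assms(2,3)
proof (induction x rule: dec_induct)
  case base
  then show ?case by simp
next
  case (step x)
  then have "f (Suc x) = f x - l * (\<Sum>z=1..x. f z) / c x"
    using diff[of x] by simp
  then show ?case
    using step volterra_sum_Suc[of x c f] by (simp add: algebra_simps)
qed

lemma shoot_Suc_diff:
  assumes "1 \<le> x"
  shows "shoot c l (Suc x) - shoot c l x = - l * (\<Sum>z=1..x. shoot c l z) / c x"
  unfolding shoot.simps[of c l "Suc x"] shoot.simps[of c l x] volterra_sum_Suc[OF assms]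
  by (simp add: algebra_simps)

section \<open>Fluxes, eigenfunctions and the right boundary condition\<close>

lemma cgrad_shoot:
  assumes pos: "\<And>x. 1 \<le> x \<Longrightarrow> x < N \<Longrightarrow> 0 < c x"
    and f: "\<And>z. z \<in> {1..N} \<Longrightarrow> f z = shoot c l z" and "1 \<le> x" "x \<le> N"
  shows "cgrad N c f x = - l * (\<Sum>z\<in>{1..<x}. shoot c l z)"
proof (cases "x = 1")
  case True
  then show ?thesis by (simp add: cgrad_def)
next
  case False
  then obtain y where y: "x = Suc y" "1 \<le> y" "y < N"
    using assms by (cases x) auto
  have "c y * (f (Suc y) - f y) = - l * (\<Sum>z=1..y. shoot c l z)"
    using shoot_Suc_diff[OF y(2), of c l] f[of y] f[of "Suc y"] y pos[of y] by simp
  then show ?thesis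
    using y by (simp add: cgrad_def atLeastLessThanSuc_atLeastAtMost)
qed

text \<open>The Neumann condition at \<open>1\<close> starts the flux at zero, so summing the
  eigenvalue equation from the left yields the Volterra equation, whose solution is fixed by
  \<open>f 1\<close>. This contains both the simplicity of the eigenvalues and the fact that no
  eigenfunction vanishes at \<open>1\<close>.\<close>

lemma eigenfunction_eq_shoot:
  assumes pos: "\<And>x. 1 \<le> x \<Longrightarrow> x < N \<Longrightarrow> 0 < c x"
    and eig: "\<And>x. x \<in> {1..N} \<Longrightarrow> generator N c f x = - l * f x"
    and "x \<in> {1..N}"
  shows "f x = f 1 * shoot c l x"
proof -
  have flux: "cgrad N c f (Suc x) = - l * (\<Sum>z=1..x. f z)" if "x \<le> N" for x
    using that
  proof (induction x)
    case 0
    then show ?case by (simp add: cgrad_def)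
  next
    case (Suc x)
    then have "cgrad N c f (Suc (Suc x)) = cgrad N c f (Suc x) - l * f (Suc x)"
      using eig[of "Suc x"] by (simp add: generator_def)
    then show ?case using Suc by (simp add: algebra_simps)
  qed
  have "f (Suc x) - f x = - l * (\<Sum>z=1..x. f z) / c x" if "1 \<le> x" "x < N" for x
    using flux[of x] that pos[of x] by (simp add: cgrad_def field_simps)
  note volt = volterra_of_differences[of N f l c, OF this]
  show ?thesis
    using assms(3)
  proof (induction x rule: less_induct)
    case (less x)
    have "f x = f 1 - l * (\<Sum>z\<in>{1..<x}. resistance c z x * f z)"
      using less.prems by (intro volt) auto
    also have "(\<Sum>z\<in>{1..<x}. resistance c z x * f z)
        = f 1 * (\<Sum>z\<in>{1..<x}. resistance c z x * shoot c l z)"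
      unfolding sum_distrib_left
    proof (intro sum.cong refl)
      fix z assume "z \<in> {1..<x}"
      then have "f z = f 1 * shoot c l z" using less.prems by (intro less.IH) auto
      then show "resistance c z x * f z = f 1 * (resistance c z x * shoot c l z)"
        by (simp only: mult.left_commute)
    qed
    finally show ?case
      by (subst shoot.simps) (simp add: algebra_simps)
  qed
qed

text \<open>At sites before \<open>N\<close> the equation holds for every \<open>l\<close>; the
  vanishing total makes the flux formula agree with the zero flux at \<open>N + 1\<close>. Agreement
  of \<open>f\<close> with \<open>shoot\<close> is demanded only on \<open>{1..N}\<close>, so that
  restrictions are covered.\<close>

lemma generator_shoot:
  assumes pos: "\<And>x. 1 \<le> x \<Longrightarrow> x < N \<Longrightarrow> 0 < c x"
    and f: "\<And>z. z \<in> {1..N} \<Longrightarrow> f z = shoot c l z"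
    and sum0: "(\<Sum>z=1..N. shoot c l z) = 0" and x: "x \<in> {1..N}"
  shows "generator N c f x = - l * f x"
proof -
  have *: "cgrad N c f x = - l * (\<Sum>z\<in>{1..<x}. shoot c l z)"
    using x by (intro cgrad_shoot[OF pos f]) auto
  have "cgrad N c f (Suc x) = - l * (\<Sum>z\<in>{1..<Suc x}. shoot c l z)"
  proof (cases "x = N")
    case True
    then show ?thesis
      using sum0 by (simp add: cgrad_def atLeastLessThanSuc_atLeastAtMost)
  next
    case False
    then show ?thesis using x by (intro cgrad_shoot[OF pos f]) auto
  qed
  then show ?thesis
    using * f[OF x] x by (simp add: generator_def algebra_simps)
qed

text \<open>The generator sums to zero over \<open>{1..N}\<close> by telescoping and the two Neumann
  conditions, so an eigenfunction for \<open>l \<noteq> 0\<close> has sum zero; the converse is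
  \<open>generator_shoot\<close>. For \<open>l = 0\<close> the constants are eigenfunctions with
  nonzero sum, hence the exclusion.\<close>

lemma is_eigenvalue_iff_sum_shoot:
  assumes pos: "\<And>x. 1 \<le> x \<Longrightarrow> x < N \<Longrightarrow> 0 < c x" and "1 \<le> N" "l \<noteq> 0"
  shows "is_eigenvalue_neg_generator N c l \<longleftrightarrow> (\<Sum>z=1..N. shoot c l z) = 0"
proof
  assume "is_eigenvalue_neg_generator N c l"
  then obtain f where f: "\<exists>x\<in>{1..N}. f x \<noteq> 0"
      and eig: "\<And>x. x \<in> {1..N} \<Longrightarrow> - generator N c f x = l * f x"
    unfolding is_eigenvalue_neg_generator_def by blast
  have eig': "generator N c f x = - l * f x" if "x \<in> {1..N}" for x
    using eig[OF that] by linarith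
  have shoot: "f x = f 1 * shoot c l x" if "x \<in> {1..N}" for x
    using that by (intro eigenfunction_eq_shoot[OF pos eig'])
  have "f 1 \<noteq> 0" using f shoot by (metis mult_zero_left)
  have "(\<Sum>x=1..N. generator N c f x) = cgrad N c f (N + 1) - cgrad N c f 1"
    unfolding generator_def using sum_Suc_diff[of 1 N "cgrad N c f"] \<open>1 \<le> N\<close> by simp
  also have "\<dots> = 0" by (simp add: cgrad_def)
  finally have "- l * (\<Sum>x=1..N. f x) = 0"
    using eig' by (simp add: sum_distrib_left)
  then have "(\<Sum>x=1..N. f x) = 0" using \<open>l \<noteq> 0\<close> by simp
  moreover have "(\<Sum>x=1..N. f x) = f 1 * (\<Sum>x=1..N. shoot c l x)"
    unfolding sum_distrib_left by (intro sum.cong refl shoot)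
  ultimately show "(\<Sum>z=1..N. shoot c l z) = 0" using \<open>f 1 \<noteq> 0\<close> by simp
next
  assume sum0: "(\<Sum>z=1..N. shoot c l z) = 0"
  have "generator N c (shoot c l) x = - l * shoot c l x" if "x \<in> {1..N}" for x
    using that by (intro generator_shoot[OF pos _ sum0]) auto
  then show "is_eigenvalue_neg_generator N c l"
    unfolding is_eigenvalue_neg_generator_def using \<open>1 \<le> N\<close>
    by (intro exI[of _ "shoot c l"]) (auto intro!: bexI[of _ 1])
qed

text \<open>Existence for the definite description comes from \<open>generator_shoot\<close>;
  uniqueness comes from \<open>eigenfunction_eq_shoot\<close> on \<open>{1..N}\<close> and from
  extensionality elsewhere.\<close>

lemma gap_eigenfunction_eq_shoot:
  assumes pos: "\<And>x. 1 \<le> x \<Longrightarrow> x < N \<Longrightarrow> 0 < c x"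
    and sum0: "(\<Sum>z=1..N. shoot c (spectral_gap N c) z) = 0" and x: "x \<in> {1..N}"
  shows "gap_eigenfunction N c x = shoot c (spectral_gap N c) x"
proof -
  let ?l = "spectral_gap N c"
  let ?g = "restrict (shoot c ?l) {1..N}"
  have "gap_eigenfunction N c = ?g"
    unfolding gap_eigenfunction_def
  proof (rule the_equality)
    have "generator N c ?g x = - ?l * ?g x" if "x \<in> {1..N}" for x
      using that by (intro generator_shoot[OF pos _ sum0]) auto
    then show "?g \<in> extensional {1..N} \<and>
        (\<forall>x\<in>{1..N}. generator N c ?g x = - ?l * ?g x) \<and> ?g 1 = 1"
      using x by auto
  next
    fix g
    assume g: "g \<in> extensional {1..N} \<and>
        (\<forall>x\<in>{1..N}. generator N c g x = - ?l * g x) \<and> g 1 = 1"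
    then have eig: "generator N c g x = - ?l * g x" if "x \<in> {1..N}" for x
      using that by blast
    have "g x = shoot c ?l x" if "x \<in> {1..N}" for x
      using eigenfunction_eq_shoot[OF pos eig that] g by simp
    then show "g = ?g"
      using g by (intro extensionalityI[of _ "{1..N}"]) auto
  qed
  then show ?thesis using x by simp
qed

section \<open>Trigonometric identities and a discrete Gronwall inequality\<close>

lemma sum_cos_midpoints:
  "2 * sin (t / 2) * (\<Sum>z=1..x. cos (t * (real z - 1/2))) = sin (t * real x)"
proof (induction x)
  case (Suc x)
  define u where "u = t * (real (Suc x) - 1/2)"
  have "t * real (Suc x) = u + t / 2" "t * real x = u - t / 2"
    by (simp_all add: u_def field_simps)
  \<comment> \<open>Each summand becomes a difference of sines, so the sum telescopes.\<close>
  then have "2 * sin (t / 2) * cos u = sin (t * real (Suc x)) - sin (t * real x)"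
    by (simp add: sin_add sin_diff)
  then show ?case using Suc by (simp add: u_def distrib_left)
qed simp

lemma cos_midpoint_Suc_diff:
  "cos (t * (real (Suc x) - 1/2)) - cos (t * (real x - 1/2)) = - 2 * sin (t / 2) * sin (t * real x)"
proof -
  have "t * (real (Suc x) - 1/2) = t * real x + t / 2" "t * (real x - 1/2) = t * real x - t / 2"
    by (simp_all add: field_simps)
  then show ?thesis by (simp add: cos_add cos_diff)
qed

text \<open>The majorant \<open>A * (1 + k) ^ (x - 1)\<close> satisfies the recursion with equality
  (this is \<open>geo\<close>), so strong induction transfers it to \<open>u\<close>.\<close>

lemma discrete_gronwall:
  fixes u :: "nat \<Rightarrow> real"
  assumes "0 \<le> k"
    and u: "\<And>x. 1 \<le> x \<Longrightarrow> x \<le> N \<Longrightarrow> u x \<le> A + k * (\<Sum>z\<in>{1..<x}. u z)"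
    and "1 \<le> x" "x \<le> N"
  shows "u x \<le> A * (1 + k) ^ (x - 1)"
  using assms(3,4)
proof (induction x rule: less_induct)
  case (less x)
  have geo: "A + k * (\<Sum>z\<in>{1..<Suc n}. A * (1 + k) ^ (z - 1)) = A * (1 + k) ^ n" for n
    by (induction n) (simp_all add: algebra_simps)
  have "u x \<le> A + k * (\<Sum>z\<in>{1..<x}. u z)"
    using less.prems by (rule u)
  also have "\<dots> \<le> A + k * (\<Sum>z\<in>{1..<x}. A * (1 + k) ^ (z - 1))"
    using less \<open>0 \<le> k\<close> by (intro add_left_mono mult_left_mono sum_mono) auto
  also have "\<dots> = A * (1 + k) ^ (x - 1)"
    using geo[of "x - 1"] less.prems by simp
  finally show ?case .
qed

lemma abs_sin_diff_le: "\<bar>sin a - sin b\<bar> \<le> \<bar>a - b :: real\<bar>"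
proof -
  have "\<bar>sin a - sin b\<bar> = 2 * \<bar>sin ((a - b) / 2)\<bar> * \<bar>cos ((a + b) / 2)\<bar>"
    unfolding sin_diff_sin by (simp add: abs_mult)
  also have "\<dots> \<le> 2 * \<bar>(a - b) / 2\<bar> * 1"
    by (intro mult_mono abs_sin_x_le_abs_x) auto
  finally show ?thesis by simp
qed

lemma abs_cos_diff_le: "\<bar>cos a - cos b\<bar> \<le> \<bar>a - b :: real\<bar>"
  using abs_sin_diff_le[of "pi / 2 - a" "pi / 2 - b"] by (simp add: sin_cos_eq[symmetric] cos_sin_eq)

section \<open>Comparison with the cosine\<close>

definition eigval :: "nat \<Rightarrow> real \<Rightarrow> real" where
  "eigval N s = 4 * (sin (s / (2 * real N)))\<^sup>2"

lemma eigval_nonneg: "0 \<le> eigval N s"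
  by (simp add: eigval_def)

lemma eigval_le:
  assumes "1 \<le> N" shows "eigval N s \<le> s\<^sup>2 / (real N)\<^sup>2"
proof -
  have "\<bar>sin (s / (2 * real N))\<bar> \<le> \<bar>s / (2 * real N)\<bar>"
    by (rule abs_sin_x_le_abs_x)
  from power_mono[OF this abs_ge_zero, of 2] show ?thesis
    by (simp add: eigval_def power_divide power_mult_distrib)
qed

text \<open>Gronwall is applied to the difference of two Volterra equations, with
  \<open>l * N^2 <= 25\<close> for \<open>l = eigval N s\<close>. The term \<open>3 / N\<close>
  arises because the cosine starts at \<open>cos (s / (2 * N))\<close> instead of \<open>1\<close>,
  the term \<open>25 * e\<close> from at most \<open>N\<close> resistance errors of size
  \<open>N * e\<close>, and the exponent \<open>50\<close> from resistances of at most
  \<open>2 * N\<close>. The range up to \<open>5\<close> leaves room for \<open>pi + d\<close> with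
  \<open>d <= 1/2\<close>.\<close>

lemma shoot_close_to_cos:
  assumes res: "\<And>n m. 1 \<le> n \<Longrightarrow> n < m \<Longrightarrow> m \<le> N \<Longrightarrow>
        \<bar>resistance c n m - (real m - real n)\<bar> \<le> real N * e"
    and e: "0 \<le> e" "e \<le> 1" and s: "0 \<le> s" "s \<le> 5" and x: "1 \<le> x" "x \<le> N"
  shows "\<bar>shoot c (eigval N s) x - cos (s / N * (real x - 1/2))\<bar> \<le> (3 / N + 25 * e) * exp 50"
proof -
  define w where "w = (\<lambda>x. cos (s / N * (real x - 1/2)))"
  define g where "g = shoot c (eigval N s)"
  define l where "l = eigval N s"
  define A where "A = 3 / N + 25 * e"
  have N: "1 \<le> N" using x by simp
  have l: "0 \<le> l" "l * (real N)\<^sup>2 \<le> 25"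
  proof -
    have "l * (real N)\<^sup>2 \<le> s\<^sup>2"
      using eigval_le[OF N, of s] N by (simp add: l_def field_simps)
    also have "\<dots> \<le> 5\<^sup>2" using s by (intro power_mono) auto
    finally show "l * (real N)\<^sup>2 \<le> 25" by simp
  qed (simp add: l_def eigval_nonneg)
  \<comment> \<open>The cosine solves the problem with unit conductances; the division by
    \<open>1\<close> matches the conductance in \<open>volterra_of_differences\<close>.\<close>
  have w_diff: "w (Suc x) - w x = - l * (\<Sum>z=1..x. w z) / 1" for x
  proof -
    have "w (Suc x) - w x = - 2 * sin (s / N / 2) * sin (s / N * x)"
      unfolding w_def by (rule cos_midpoint_Suc_diff)
    also have "sin (s / N * x) = 2 * sin (s / N / 2) * (\<Sum>z=1..x. w z)"
      unfolding w_def by (rule sum_cos_midpoints[symmetric])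
    also have "- 2 * sin (s / N / 2) * \<dots> = - l * (\<Sum>z=1..x. w z) / 1"
      by (simp add: l_def eigval_def power2_eq_square mult.commute)
    finally show ?thesis .
  qed
  have w: "w x = w 1 - l * (\<Sum>z\<in>{1..<x}. resistance (\<lambda>_. 1) z x * w z)"
    if "1 \<le> x" for x
    using that by (intro volterra_of_differences[where N = x] w_diff) auto
  have w1: "\<bar>1 - w 1\<bar> \<le> 3 / N"
  proof -
    have "\<bar>1 - w 1\<bar> \<le> \<bar>0 - s / N * (1/2)\<bar>"
      using abs_cos_diff_le[of 0 "s / N * (1/2)"] by (simp add: w_def mult.commute)
    also have "\<dots> \<le> 3 / N"
      using s N by (simp add: field_simps)
    finally show ?thesis .
  qed
  have bound: "\<bar>g x - w x\<bar> \<le> A + 50 / N * (\<Sum>z\<in>{1..<x}. \<bar>g z - w z\<bar>)"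
    if x: "1 \<le> x" "x \<le> N" for x
  proof -
    have summand: "\<bar>resistance c z x * g z - resistance (\<lambda>_. 1) z x * w z\<bar>
        \<le> real N * e + 2 * real N * \<bar>g z - w z\<bar>" if z: "z \<in> {1..<x}" for z
    proof -
      have r: "\<bar>resistance c z x - (real x - real z)\<bar> \<le> real N * e"
        using z x by (intro res) auto
      have r1: "resistance (\<lambda>_. 1) z x = real x - real z"
        using z by (simp add: resistance_def of_nat_diff)
      have "\<bar>resistance c z x\<bar> \<le> real N * e + real N"
        using r z x by auto
      also have "\<dots> \<le> 2 * real N" using mult_left_mono[of e 1 "real N"] e by simp
      finally have r2: "\<bar>resistance c z x\<bar> \<le> 2 * real N" .
      \<comment> \<open>The split charges the resistance error to the bounded \<open>w\<close> and
        the full resistance to \<open>g - w\<close>, the quantity that Gronwall controls.\<close>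
      have "resistance c z x * g z - resistance (\<lambda>_. 1) z x * w z
          = (resistance c z x - (real x - real z)) * w z + resistance c z x * (g z - w z)"
        by (simp add: r1 algebra_simps)
      also have "\<bar>\<dots>\<bar> \<le> \<bar>resistance c z x - (real x - real z)\<bar> * \<bar>w z\<bar>
          + \<bar>resistance c z x\<bar> * \<bar>g z - w z\<bar>"
        by (metis abs_mult abs_triangle_ineq)
      also have "\<dots> \<le> (real N * e) * 1 + 2 * real N * \<bar>g z - w z\<bar>"
        using r r2 e by (intro add_mono mult_mono) (auto simp: w_def)
      finally show ?thesis by simp
    qed
    have "g x - w x = (1 - w 1) - l * (\<Sum>z\<in>{1..<x}.
        resistance c z x * g z - resistance (\<lambda>_. 1) z x * w z)"
      unfolding sum_subtractf w[OF x(1)] g_def l_def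
      by (subst shoot.simps) (simp add: algebra_simps)
    also have "\<bar>\<dots>\<bar> \<le> \<bar>1 - w 1\<bar> + l * (\<Sum>z\<in>{1..<x}.
        \<bar>resistance c z x * g z - resistance (\<lambda>_. 1) z x * w z\<bar>)"
      using mult_left_mono[OF sum_abs l(1)] l(1)
      by (intro order.trans[OF abs_triangle_ineq4] add_left_mono) (simp add: abs_mult)
    also have "\<dots> \<le> 3 / N + l * (\<Sum>z\<in>{1..<x}. real N * e + 2 * real N * \<bar>g z - w z\<bar>)"
      using w1 l summand by (intro add_mono mult_left_mono sum_mono) auto
    also have "\<dots> = 3 / N + l * (real (x - 1) * real N * e)
        + 2 * (l * real N) * (\<Sum>z\<in>{1..<x}. \<bar>g z - w z\<bar>)"
      by (simp add: sum.distrib sum_distrib_left algebra_simps)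
    also have "\<dots> \<le> A + 50 / N * (\<Sum>z\<in>{1..<x}. \<bar>g z - w z\<bar>)"
      unfolding A_def
    proof (intro add_mono mult_right_mono)
      have "l * (real (x - 1) * real N * e) \<le> l * (real N * real N * e)"
        using l x e by (intro mult_left_mono mult_right_mono) auto
      also have "\<dots> = l * (real N)\<^sup>2 * e" by (simp add: power2_eq_square)
      also have "\<dots> \<le> 25 * e" using l e by (intro mult_right_mono)
      finally show "l * (real (x - 1) * real N * e) \<le> 25 * e" .
      show "2 * (l * real N) \<le> 50 / N"
        using l N by (simp add: field_simps power2_eq_square)
    qed (auto intro: sum_nonneg)
    finally show ?thesis .
  qed
  have "\<bar>g x - w x\<bar> \<le> A * (1 + 50 / N) ^ (x - 1)"
    using x by (intro discrete_gronwall[where N = N] bound) auto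
  also have "\<dots> \<le> A * exp 50"
  proof (intro mult_left_mono)
    have "(1 + 50 / real N) ^ (x - 1) \<le> (1 + 50 / real N) ^ N"
      using x by (intro power_increasing) auto
    also have "\<dots> \<le> exp (50 / real N) ^ N"
      by (intro power_mono exp_ge_add_one_self) auto
    also have "\<dots> = exp 50"
      using N by (simp flip: exp_of_nat_mult)
    finally show "(1 + 50 / real N) ^ (x - 1) \<le> exp 50" .
    show "0 \<le> A" using e by (simp add: A_def)
  qed
  finally show ?thesis by (simp add: g_def w_def A_def)
qed

section \<open>Sign of the cosine sum over \<open>{1..N}\<close>\<close>

lemma sin_ge_sin_margin:
  fixes s d :: real
  assumes "0 \<le> d" "d \<le> s" "s \<le> pi - d"
  shows "sin d \<le> sin s"
proof (cases "s \<le> pi / 2")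
  case True
  then show ?thesis using assms by (intro sin_monotone_2pi_le) auto
next
  case False
  then have "sin d \<le> sin (pi - s)" using assms by (intro sin_monotone_2pi_le) auto
  then show ?thesis by simp
qed

text \<open>For \<open>N >= 2\<close> and \<open>s <= 5\<close> the half angle stays below
  \<open>pi\<close>, so the factor is positive. Hence the sum has the sign of \<open>sin s\<close>
  and absolute value at least \<open>N * \<bar>sin s\<bar> / 5\<close>, the source of the margin
  \<open>sin d / 5\<close> used below.\<close>

lemma sum_cos_bounds:
  assumes N: "2 \<le> N" and s: "0 < s" "s \<le> 5"
  shows "0 < 2 * sin (s / N / 2)" "2 * sin (s / N / 2) \<le> 5 / N"
    and "2 * sin (s / N / 2) * (\<Sum>z=1..N. cos (s / N * (real z - 1/2))) = sin s"
proof -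
  have "s / N \<le> 5 / N" using s by (intro divide_right_mono) auto
  also have "5 / real N \<le> 5 / 2" using N by (intro divide_left_mono) auto
  finally have "s / N / 2 \<le> 5 / 2 / 2" by (rule divide_right_mono) simp
  also have "\<dots> < pi" using pi_gt3 by simp
  finally have "s / N / 2 < pi" .
  then show "0 < 2 * sin (s / N / 2)" using s N by (simp add: sin_gt_zero)
  have "2 * sin (s / N / 2) \<le> s / N" using sin_x_le_x[of "s / N / 2"] s by simp
  then show "2 * sin (s / N / 2) \<le> 5 / N" using \<open>s / N \<le> 5 / N\<close> by simp
  show "2 * sin (s / N / 2) * (\<Sum>z=1..N. cos (s / N * (real z - 1/2))) = sin s"
    using sum_cos_midpoints[of "s / N" N] N by simp
qed

text \<open>Near \<open>s = 0\<close> the closed form gives no margin since \<open>sin s\<close> is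
  small, but every cosine is at least \<open>1/2\<close> for \<open>s <= pi / 3\<close>. Beyond
  that, \<open>d <= 1/2 < pi / 3 < s\<close> puts \<open>s\<close> into \<open>[d, pi - d]\<close>,
  where \<open>sin s >= sin d\<close>.\<close>

lemma sum_cos_ge:
  assumes N: "2 \<le> N" and d: "0 < d" "d \<le> 1/2" and s: "0 < s" "s \<le> pi - d"
  shows "real N * (sin d / 5) \<le> (\<Sum>z=1..N. cos (s / N * (real z - 1/2)))"
proof (cases "s \<le> pi / 3")
  case True
  have "sin d / 5 \<le> cos (s / N * (real z - 1/2))" if z: "z \<in> {1..N}" for z
  proof -
    have "s / N * (real z - 1/2) \<le> s / N * N"
      using z s by (intro mult_left_mono) auto
    also have "\<dots> \<le> pi / 3" using True N by simp
    finally have "cos (pi / 3) \<le> cos (s / N * (real z - 1/2))"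
      using z s by (intro cos_monotone_0_pi_le) auto
    moreover have "sin d \<le> 1" by simp
    ultimately show ?thesis by (simp only: cos_60)
  qed
  then have "(\<Sum>z=1..N. sin d / 5) \<le> (\<Sum>z=1..N. cos (s / N * (real z - 1/2)))"
    by (rule sum_mono)
  then show ?thesis by simp
next
  case False
  define W where "W = (\<Sum>z=1..N. cos (s / N * (real z - 1/2)))"
  have s5: "s \<le> 5" using s d pi_less_4 by simp
  note W = sum_cos_bounds[OF N s(1) s5, folded W_def]
  have "sin d \<le> sin s" using False s d pi_gt3 by (intro sin_ge_sin_margin) auto
  moreover have "0 < sin d" using d pi_gt3 by (intro sin_gt_zero) auto
  ultimately have "0 < W" using W(1,3) by (metis less_le_trans zero_less_mult_pos)
  then have "sin s \<le> 5 / N * W"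
    using W(2,3) mult_right_mono[of "2 * sin (s / N / 2)" "5 / N" W] by simp
  then have "sin d \<le> 5 / N * W" using \<open>sin d \<le> sin s\<close> by simp
  then have "real N * (sin d / 5) \<le> W" using N by (simp add: field_simps)
  then show ?thesis by (simp only: W_def)
qed

text \<open>Past \<open>pi\<close> the closed form turns negative, as
  \<open>sin (pi + d) = - sin d\<close>.\<close>

lemma sum_cos_le:
  assumes N: "2 \<le> N" and d: "0 < d" "d \<le> 1/2"
  shows "(\<Sum>z=1..N. cos ((pi + d) / N * (real z - 1/2))) \<le> - (real N * (sin d / 5))"
proof -
  define W where "W = (\<Sum>z=1..N. cos ((pi + d) / N * (real z - 1/2)))"
  have s: "0 < pi + d" "pi + d \<le> 5" using d pi_gt3 pi_less_4 by auto
  note W = sum_cos_bounds[OF N s, folded W_def]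
  have "0 < sin d" using d pi_gt3 by (intro sin_gt_zero) auto
  moreover have "2 * sin ((pi + d) / N / 2) * W = - sin d"
    using W(3) by (simp add: sin_add)
  ultimately have "W < 0"
    using W(1) by (smt (verit) mult_nonneg_nonneg)
  then have "5 / N * W \<le> - sin d"
    using W(2) mult_right_mono_neg[of "2 * sin ((pi + d) / N / 2)" "5 / N" W]
      \<open>2 * sin ((pi + d) / N / 2) * W = - sin d\<close> by simp
  then have "W \<le> - (real N * (sin d / 5))" using N by (simp add: field_simps)
  then show ?thesis by (simp only: W_def)
qed

section \<open>Location of the spectral gap\<close>

lemma continuous_on_eigval: "continuous_on S (eigval N)"
proof (cases "N = 0")
  case True
  then show ?thesis by (simp add: eigval_def[abs_def])
next
  case False
  then show ?thesis unfolding eigval_def[abs_def] by (intro continuous_intros) auto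
qed

text \<open>By \<open>small\<close> the error per site is below \<open>sin d / 5\<close>, the margin
  of the cosine sums, so \<open>F\<close> inherits their sign: positive on \<open>(0, a]\<close> and
  negative at \<open>b\<close>. The gap is the first zero of \<open>F\<close> in
  \<open>[a, b]\<close>. The vanishing sum is returned as well because the identification of the
  eigenfunction depends on it.\<close>

lemma spectral_gap_eq_eigval:
  assumes N: "2 \<le> N" and pos: "\<And>x. 1 \<le> x \<Longrightarrow> x < N \<Longrightarrow> 0 < c x"
    and res: "\<And>n m. 1 \<le> n \<Longrightarrow> n < m \<Longrightarrow> m \<le> N \<Longrightarrow>
        \<bar>resistance c n m - (real m - real n)\<bar> \<le> real N * e"
    and e: "0 \<le> e" "e \<le> 1" and d: "0 < d" "d \<le> 1/2"
    and small: "(3 / N + 25 * e) * exp 50 < sin d / 5"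
  obtains s where "\<bar>s - pi\<bar> \<le> d" "spectral_gap N c = eigval N s"
    "(\<Sum>z=1..N. shoot c (spectral_gap N c) z) = 0"
proof -
  define F where "F = (\<lambda>l. \<Sum>z=1..N. shoot c l z)"
  define a where "a = eigval N (pi - d)"
  define b where "b = eigval N (pi + d)"
  have cont: "continuous_on S F" for S
    unfolding F_def by (intro continuous_on_sum continuous_on_shoot)
  have F_near: "\<bar>F (eigval N s) - (\<Sum>z=1..N. cos (s / N * (real z - 1/2)))\<bar> < N * (sin d / 5)"
    if "0 \<le> s" "s \<le> 5" for s
  proof -
    have "\<bar>F (eigval N s) - (\<Sum>z=1..N. cos (s / N * (real z - 1/2)))\<bar>
        \<le> (\<Sum>z=1..N. \<bar>shoot c (eigval N s) z - cos (s / N * (real z - 1/2))\<bar>)"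
      unfolding F_def sum_subtractf[symmetric] by (rule sum_abs)
    also have "\<dots> < (\<Sum>z=1..N. sin d / 5)"
    proof (rule sum_strict_mono)
      fix z assume "z \<in> {1..N}"
      then have "\<bar>shoot c (eigval N s) z - cos (s / N * (real z - 1/2))\<bar>
          \<le> (3 / N + 25 * e) * exp 50"
        using that by (intro shoot_close_to_cos[OF res e]) auto
      then show "\<bar>shoot c (eigval N s) z - cos (s / N * (real z - 1/2))\<bar> < sin d / 5"
        using small by simp
    qed (use N in auto)
    finally show ?thesis by simp
  qed
  have pi_d: "0 < pi - d" "pi + d \<le> 5" using d pi_gt3 pi_less_4 by auto
  have F_pos: "0 < F (eigval N s)" if "0 < s" "s \<le> pi - d" for s
    using F_near[of s] sum_cos_ge[OF N d that] that pi_d d by linarith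
  \<comment> \<open>Since \<open>N >= 2\<close> bounds \<open>v\<close> by \<open>5/4\<close>, both
    angles lie in \<open>[0, pi / 2]\<close>, where the sine increases.\<close>
  have ab: "0 < a" "a \<le> b"
  proof -
    define u where "u = (pi - d) / (2 * N)"
    define v where "v = (pi + d) / (2 * N)"
    have "v \<le> 5 / (2 * 2)"
      unfolding v_def using pi_d N by (intro frac_le) auto
    then have "v \<le> pi / 2" using pi_gt3 by linarith
    moreover have "0 < u" "u \<le> v"
      using pi_d d N by (auto simp: u_def v_def intro: divide_right_mono)
    ultimately have "0 < sin u" "sin u \<le> sin v"
      using pi_gt3 by (auto intro!: sin_gt_zero sin_monotone_2pi_le)
    then show "0 < a" "a \<le> b"
      by (auto simp: a_def b_def eigval_def u_def v_def intro!: power_mono)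
  qed
  \<comment> \<open>\<open>eigval N\<close> is continuous and runs from \<open>0\<close> to
    \<open>a\<close> on \<open>[0, pi - d]\<close>, so every candidate up to \<open>a\<close> is
    covered by \<open>F_pos\<close>.\<close>
  have no_small: "F l \<noteq> 0" if l: "0 < l" "l \<le> a" for l
  proof -
    have "\<exists>s\<ge>0. s \<le> pi - d \<and> eigval N s = l"
      using l pi_d by (intro IVT' continuous_on_eigval) (auto simp: a_def, simp add: eigval_def)
    then obtain s where s: "0 \<le> s" "s \<le> pi - d" "eigval N s = l" by blast
    moreover have "s \<noteq> 0" using s l by (auto simp: eigval_def)
    ultimately show ?thesis using F_pos[of s] by auto
  qed
  have "F b < 0"
    using F_near[of "pi + d"] sum_cos_le[OF N d] pi_d d unfolding b_def by linarith
  moreover have "0 < F a" unfolding a_def using pi_d by (intro F_pos) auto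
  ultimately obtain l0 where l0: "a \<le> l0" "l0 \<le> b" "F l0 = 0"
    using IVT2'[of F b 0 a] ab cont by auto
  \<comment> \<open>\<open>LEAST\<close> over the reals needs an attained minimum, and the zero
    \<open>l0\<close> need not be the smallest; compactness of the zero set supplies the smallest
    one.\<close>
  define Z where "Z = {l \<in> {a..b}. F l = 0}"
  have "Z = {a..b} \<inter> {l \<in> {a..b}. F l = 0}" by (auto simp: Z_def)
  also have "compact \<dots>"
    using cont by (intro compact_Int_closed continuous_closed_preimage_constant) auto
  finally have "compact Z" .
  moreover have "Z \<noteq> {}" using l0 by (auto simp: Z_def)
  ultimately have "\<exists>l\<in>Z. \<forall>k\<in>Z. l \<le> k" by (rule compact_attains_inf)
  then obtain l where l: "l \<in> Z" "\<And>k. k \<in> Z \<Longrightarrow> l \<le> k"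
    by blast
  have gap: "spectral_gap N c = l"
    unfolding spectral_gap_def
  proof (rule Least_equality)
    have "0 < l" "F l = 0" using l ab by (auto simp: Z_def)
    then show "0 < l \<and> is_eigenvalue_neg_generator N c l"
      using is_eigenvalue_iff_sum_shoot[of N c l] pos N by (simp add: F_def)
  next
    fix k assume k: "0 < k \<and> is_eigenvalue_neg_generator N c k"
    then have "F k = 0"
      using is_eigenvalue_iff_sum_shoot[of N c k] pos N by (simp add: F_def)
    then have "a < k" using no_small[of k] k by force
    show "l \<le> k"
    proof (cases "k \<le> b")
      case True
      then show ?thesis using \<open>a < k\<close> \<open>F k = 0\<close> by (intro l(2)) (simp add: Z_def)
    next
      case False
      then show ?thesis using l(1) by (simp add: Z_def)
    qed
  qed
  \<comment> \<open>The gap is translated back into a frequency within \<open>d\<close> of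
    \<open>pi\<close>.\<close>
  have "\<exists>s\<ge>pi - d. s \<le> pi + d \<and> eigval N s = l"
    using l(1) d by (intro IVT' continuous_on_eigval) (auto simp: Z_def a_def b_def)
  then obtain s where "pi - d \<le> s" "s \<le> pi + d" "eigval N s = l" by blast
  then show ?thesis
    using l(1) gap by (intro that[of s]) (auto simp: Z_def F_def)
qed

section \<open>Gap, eigenfunction and flux estimates for fixed \<open>N\<close>\<close>

lemma cgrad_cos_profile:
  assumes "1 \<le> x" "x \<le> N"
  shows "cgrad N (\<lambda>_. 1) (cos_profile N) x = - 2 * sin (pi / N / 2) * sin (pi / N * real (x - 1))"
proof (cases "x = 1")
  \<comment> \<open>The Neumann convention agrees with the formula because
    \<open>sin 0 = 0\<close>.\<close>
  case True
  then show ?thesis by (simp add: cgrad_def)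
next
  case False
  then obtain y where "x = Suc y" "1 \<le> y" using assms by (cases x) auto
  then show ?thesis
    using cos_midpoint_Suc_diff[of "pi / N" y] assms by (simp add: cgrad_def cos_profile_def)
qed

text \<open>\<open>2 * N * sin (s / N / 2)\<close> is a signed square root of
  \<open>N^2 * eigval N s\<close>. It is 1-Lipschitz in \<open>s\<close> uniformly in
  \<open>N\<close>, which is why gaps are compared through their square roots.\<close>

lemma abs_scaled_sin_diff_le:
  assumes "1 \<le> N"
  shows "\<bar>2 * real N * sin (s / N / 2) - 2 * real N * sin (t / N / 2)\<bar> \<le> \<bar>s - t\<bar>"
proof -
  have "\<bar>2 * real N * sin (s / N / 2) - 2 * real N * sin (t / N / 2)\<bar>
      = 2 * real N * \<bar>sin (s / N / 2) - sin (t / N / 2)\<bar>"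
    by (simp add: abs_mult flip: right_diff_distrib)
  also have "\<dots> \<le> 2 * real N * \<bar>s / N / 2 - t / N / 2\<bar>"
    by (intro mult_left_mono abs_sin_diff_le) auto
  also have "\<dots> = \<bar>2 * real N * (s / N / 2 - t / N / 2)\<bar>"
    by (simp add: abs_mult)
  also have "2 * real N * (s / N / 2 - t / N / 2) = s - t"
    using assms by (simp add: field_simps)
  finally show ?thesis .
qed

lemma abs_scaled_frac_le:
  fixes y s t :: real
  assumes "1 \<le> N" "0 \<le> y" "y \<le> real N"
  shows "\<bar>s / N * y - t / N * y\<bar> \<le> \<bar>s - t\<bar>"
proof -
  have "\<bar>s / N * y - t / N * y\<bar> = \<bar>(s - t) * (y / N)\<bar>"
    by (simp add: left_diff_distrib diff_divide_distrib)
  also have "\<dots> \<le> \<bar>s - t\<bar> * 1"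
    unfolding abs_mult using assms by (intro mult_left_mono) auto
  finally show ?thesis by simp
qed

text \<open>All errors come from \<open>\<bar>s - pi\<bar> <= d\<close> and from the distance of at
  most \<open>d / 5\<close> between \<open>shoot\<close> and the cosine of frequency
  \<open>s / N\<close>. The gap is compared with its unit-conductance counterpart, whose limit is
  taken later. The common bound \<open>10 * d\<close> is dictated by the flux.\<close>

lemma gap_close:
  assumes N: "2 \<le> N" and pos: "\<And>x. 1 \<le> x \<Longrightarrow> x < N \<Longrightarrow> 0 < c x"
    and res: "\<And>n m. 1 \<le> n \<Longrightarrow> n < m \<Longrightarrow> m \<le> N \<Longrightarrow>
        \<bar>resistance c n m - (real m - real n)\<bar> \<le> real N * e"
    and e: "0 \<le> e" "e \<le> 1" and d: "0 < d" "d \<le> 1/2"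
    and small: "(3 / N + 25 * e) * exp 50 < sin d / 5"
  shows "\<bar>sqrt ((real N)\<^sup>2 * spectral_gap N c) - \<bar>2 * real N * sin (pi / N / 2)\<bar>\<bar> \<le> 10 * d" (is ?gap)
    and "\<And>x. x \<in> {1..N} \<Longrightarrow> \<bar>gap_eigenfunction N c x - cos_profile N x\<bar> \<le> 10 * d"
    and "\<And>x. x \<in> {1..N} \<Longrightarrow> \<bar>real N * cgrad N c (gap_eigenfunction N c) x
        - real N * cgrad N (\<lambda>_. 1) (cos_profile N) x\<bar> \<le> 10 * d"
proof -
  obtain s where s: "\<bar>s - pi\<bar> \<le> d" and gap: "spectral_gap N c = eigval N s"
    and sum0: "(\<Sum>z=1..N. shoot c (spectral_gap N c) z) = 0"
    using spectral_gap_eq_eigval[OF N pos res e d small] by blast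
  define l where "l = eigval N s"
  define w where "w = (\<lambda>z. cos (s / N * (real z - 1/2)))"
  have s5: "0 \<le> s" "s \<le> 5" using s d pi_gt3 pi_less_4 by auto
  have "sin d \<le> d" using d by (intro sin_x_le_x) auto
  have close: "\<bar>shoot c l z - w z\<bar> \<le> d / 5" if "z \<in> {1..N}" for z
  proof -
    have "\<bar>shoot c l z - w z\<bar> \<le> (3 / N + 25 * e) * exp 50"
      unfolding l_def w_def using that by (intro shoot_close_to_cos[OF res e s5]) auto
    then show ?thesis using small \<open>sin d \<le> d\<close> by simp
  qed
  have eig: "gap_eigenfunction N c x = shoot c l x" if "x \<in> {1..N}" for x
    using gap_eigenfunction_eq_shoot[OF pos sum0 that] by (simp add: gap l_def)
  have "(real N)\<^sup>2 * eigval N s = (2 * real N * sin (s / N / 2))\<^sup>2"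
    by (simp add: eigval_def power_mult_distrib mult.commute)
  then have "sqrt ((real N)\<^sup>2 * spectral_gap N c) = \<bar>2 * real N * sin (s / N / 2)\<bar>"
    by (simp only: gap real_sqrt_abs)
  moreover have scaled: "\<bar>2 * real N * sin (s / N / 2) - 2 * real N * sin (pi / N / 2)\<bar> \<le> d"
    using abs_scaled_sin_diff_le[of N s pi] N s by simp
  ultimately show ?gap
    using d by linarith
  show "\<bar>gap_eigenfunction N c x - cos_profile N x\<bar> \<le> 10 * d" if x: "x \<in> {1..N}" for x
  proof -
    have "\<bar>w x - cos (pi / N * (real x - 1/2))\<bar> \<le> \<bar>s / N * (real x - 1/2) - pi / N * (real x - 1/2)\<bar>"
      unfolding w_def by (rule abs_cos_diff_le)
    also have "\<dots> \<le> \<bar>s - pi\<bar>" using x N by (intro abs_scaled_frac_le) auto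
    finally have "\<bar>w x - cos_profile N x\<bar> \<le> d" using s by (simp add: cos_profile_def)
    then show ?thesis using close[OF x] eig[OF x] d by linarith
  qed
  show "\<bar>real N * cgrad N c (gap_eigenfunction N c) x
        - real N * cgrad N (\<lambda>_. 1) (cos_profile N) x\<bar> \<le> 10 * d" if x: "x \<in> {1..N}" for x
  proof -
    define y where "y = real (x - 1)"
    \<comment> \<open>\<open>- p\<close> and \<open>- q\<close> are the amplitudes of
      \<open>N\<close> times the unit-conductance flux of the cosines of frequencies
      \<open>s / N\<close> and \<open>pi / N\<close>.\<close>
    define p where "p = 2 * real N * sin (s / N / 2)"
    define q where "q = 2 * real N * sin (pi / N / 2)"
    define W where "W = (\<Sum>z\<in>{1..<x}. w z)"
    define G where "G = (\<Sum>z\<in>{1..<x}. shoot c l z)"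
    have y: "0 \<le> y" "y \<le> real N" using x by (auto simp: y_def)
    have g: "cgrad N c (gap_eigenfunction N c) x = - l * G"
      unfolding G_def using x by (intro cgrad_shoot[OF pos eig]) auto
    have h: "real N * cgrad N (\<lambda>_. 1) (cos_profile N) x = - q * sin (pi / N * y)"
      using x by (subst cgrad_cos_profile) (auto simp: q_def y_def)
    have "W = (\<Sum>z=1..x-1. w z)"
      unfolding W_def using x by (intro sum.cong) auto
    then have "2 * sin (s / N / 2) * W = sin (s / N * y)"
      using sum_cos_midpoints[of "s / N" "x - 1"] by (simp add: w_def y_def)
    moreover have "real N * l = p * (2 * sin (s / N / 2))"
      by (simp add: l_def p_def eigval_def power2_eq_square mult.commute)
    ultimately have W: "real N * l * W = p * sin (s / N * y)" by simp
    have "\<bar>G - W\<bar> \<le> (\<Sum>z\<in>{1..<x}. \<bar>shoot c l z - w z\<bar>)"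
      unfolding G_def W_def sum_subtractf[symmetric] by (rule sum_abs)
    also have "\<dots> \<le> (\<Sum>z\<in>{1..<x}. d / 5)"
      using x by (intro sum_mono close) auto
    also have "\<dots> = y * (d / 5)" by (simp add: y_def)
    also have "\<dots> \<le> real N * (d / 5)" using y d by (intro mult_right_mono) auto
    finally have GW: "\<bar>G - W\<bar> \<le> real N * (d / 5)" .
    have l: "0 \<le> l" "(real N)\<^sup>2 * l \<le> 25"
    proof -
      have "(real N)\<^sup>2 * l \<le> s\<^sup>2"
        using eigval_le[of N s] N by (simp add: l_def field_simps)
      also have "\<dots> \<le> 5\<^sup>2" using s5 by (intro power_mono) auto
      finally show "(real N)\<^sup>2 * l \<le> 25" by simp
    qed (simp add: l_def eigval_nonneg)
    have "\<bar>real N * l * (G - W)\<bar> \<le> real N * l * (real N * (d / 5))"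
      unfolding abs_mult[of "real N * l"] using GW l by (intro mult_mono) auto
    also have "\<dots> = (real N)\<^sup>2 * l * (d / 5)" by (simp add: power2_eq_square)
    also have "\<dots> \<le> 25 * (d / 5)" using l d by (intro mult_right_mono) auto
    finally have 1: "\<bar>real N * l * (G - W)\<bar> \<le> 5 * d" by simp
    have "\<bar>(p - q) * sin (s / N * y)\<bar> \<le> d * 1"
      unfolding abs_mult using scaled d by (intro mult_mono) (auto simp: p_def q_def)
    then have 2: "\<bar>(p - q) * sin (s / N * y)\<bar> \<le> d" by simp
    have "\<bar>q\<bar> \<le> pi"
      using abs_scaled_sin_diff_le[of N pi 0] N by (simp add: q_def)
    have "\<bar>sin (s / N * y) - sin (pi / N * y)\<bar> \<le> \<bar>s / N * y - pi / N * y\<bar>"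
      by (rule abs_sin_diff_le)
    also have "\<dots> \<le> \<bar>s - pi\<bar>" using N y by (intro abs_scaled_frac_le) auto
    finally have "\<bar>q * (sin (s / N * y) - sin (pi / N * y))\<bar> \<le> pi * d"
      unfolding abs_mult[of q] using \<open>\<bar>q\<bar> \<le> pi\<close> s by (intro mult_mono) auto
    also have "\<dots> \<le> 4 * d" using pi_less_4 d by (intro mult_right_mono) auto
    finally have 3: "\<bar>q * (sin (s / N * y) - sin (pi / N * y))\<bar> \<le> 4 * d" .
    \<comment> \<open>The three terms replace the partial sum \<open>G\<close> by \<open>W\<close>
      (\<open>5 * d\<close>), the amplitude \<open>p\<close> by \<open>q\<close> (\<open>d\<close>),
      and the frequency \<open>s\<close> by \<open>pi\<close> (\<open>4 * d\<close>).\<close>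
    have "real N * cgrad N c (gap_eigenfunction N c) x
        - real N * cgrad N (\<lambda>_. 1) (cos_profile N) x
        = - (real N * l * (G - W)) - (p - q) * sin (s / N * y)
          - q * (sin (s / N * y) - sin (pi / N * y))"
      unfolding g h using W by (simp add: algebra_simps)
    then show ?thesis using 1 2 3 by linarith
  qed
qed

section \<open>Passage to the limit\<close>

lemma abs_SUP_abs_le:
  fixes f :: "'a \<Rightarrow> real"
  assumes "finite A" "A \<noteq> {}" "\<And>x. x \<in> A \<Longrightarrow> \<bar>f x\<bar> \<le> K"
  shows "\<bar>SUP x\<in>A. \<bar>f x\<bar>\<bar> \<le> K"
proof -
  obtain a where "a \<in> A" using assms(2) by blast
  then have "0 \<le> (SUP x\<in>A. \<bar>f x\<bar>)"
    using assms(1) by (intro cSUP_upper2[of _ _ a]) auto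
  moreover have "(SUP x\<in>A. \<bar>f x\<bar>) \<le> K" using assms by (intro cSUP_least) auto
  ultimately show ?thesis by simp
qed

theorem theorem1p3:
  fixes c :: "nat \<Rightarrow> nat \<Rightarrow> real"
  assumes pos: "\<And>N x. 2 \<le> N \<Longrightarrow> 1 \<le> x \<Longrightarrow> x < N \<Longrightarrow> 0 < c N x"
    and res: "limsup (\<lambda>N. ereal (1 / real N *
               (SUP (n, m) \<in> {(n, m). 1 \<le> n \<and> n < m \<and> m \<le> N}.
                  \<bar>resistance (c N) n m - (real m - real n)\<bar>))) = 0"
  shows "(\<lambda>N. (real N)\<^sup>2 * spectral_gap N (c N) / pi\<^sup>2) \<longlonglongrightarrow> 1 \<and>
         (\<lambda>N. SUP x \<in> {1..N}. \<bar>gap_eigenfunction N (c N) x - cos_profile N x\<bar>) \<longlonglongrightarrow> 0 \<and>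
         (\<lambda>N. SUP x \<in> {1..N}.
            \<bar>real N * cgrad N (c N) (gap_eigenfunction N (c N)) x
             - real N * cgrad N (\<lambda>_. 1) (cos_profile N) x\<bar>) \<longlonglongrightarrow> 0"
proof -
  have est: "\<forall>\<^sub>F N in sequentially.
      \<bar>sqrt ((real N)\<^sup>2 * spectral_gap N (c N)) - \<bar>2 * real N * sin (pi / N / 2)\<bar>\<bar> < r \<and>
      \<bar>SUP x \<in> {1..N}. \<bar>gap_eigenfunction N (c N) x - cos_profile N x\<bar>\<bar> < r \<and>
      \<bar>SUP x \<in> {1..N}. \<bar>real N * cgrad N (c N) (gap_eigenfunction N (c N)) x
             - real N * cgrad N (\<lambda>_. 1) (cos_profile N) x\<bar>\<bar> < r" if "0 < r" for r
  proof -
    \<comment> \<open>\<open>r / 11\<close> gives \<open>10 * d < r\<close>; \<open>1/2\<close> is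
      the range allowed in \<open>gap_close\<close>.\<close>
    define d where "d = min (1/2) (r / 11)"
    have d: "0 < d" "d \<le> 1/2" "10 * d < r" using \<open>0 < r\<close> by (auto simp: d_def)
    then have "0 < sin d" using pi_gt3 by (intro sin_gt_zero) auto
    \<comment> \<open>As \<open>251 > 10 * 25\<close>, the resistance term stays strictly below half
      of the budget \<open>sin d / 5\<close>; the term in \<open>1 / N\<close> eventually fits into
      the other half.\<close>
    define e where "e = min 1 (sin d / (251 * exp 50))"
    have e: "0 < e" "e \<le> 1" using \<open>0 < sin d\<close> by (auto simp: e_def)
    have e_small: "25 * e * exp 50 < sin d / 10"
    proof -
      have "25 * e * exp 50 \<le> 25 * (sin d / (251 * exp 50)) * exp 50"
        by (intro mult_right_mono mult_left_mono) (auto simp: e_def)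
      also have "\<dots> < sin d / 10" using \<open>0 < sin d\<close> by simp
      finally show ?thesis .
    qed
    have "(\<lambda>N. 3 / real N * exp 50) \<longlonglongrightarrow> 0"
      by (intro tendsto_mult_left_zero lim_const_over_n)
    then have "\<forall>\<^sub>F N in sequentially. 3 / real N * exp 50 < sin d / 10"
      using \<open>0 < sin d\<close> by (intro order_tendstoD(2)[of _ 0]) auto
    moreover have "\<forall>\<^sub>F N in sequentially. ereal (1 / real N *
               (SUP (n, m) \<in> {(n, m). 1 \<le> n \<and> n < m \<and> m \<le> N}.
                  \<bar>resistance (c N) n m - (real m - real n)\<bar>)) < ereal e"
      using e by (intro Limsup_lessD) (subst res, simp)
    ultimately show ?thesis
      using eventually_ge_at_top[of 2]
    proof eventually_elim
      case (elim N)
      let ?P = "{(n, m). 1 \<le> n \<and> n < m \<and> m \<le> N}"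
      \<comment> \<open>Finiteness bounds the family above, so that the real supremum dominates its
        members.\<close>
      have "finite ?P" by (rule finite_subset[of _ "{..N} \<times> {..N}"]) auto
      have res': "\<bar>resistance (c N) n m - (real m - real n)\<bar> \<le> real N * e"
        if "1 \<le> n" "n < m" "m \<le> N" for n m
      proof -
        have "\<bar>resistance (c N) n m - (real m - real n)\<bar>
            \<le> (SUP (n, m) \<in> ?P. \<bar>resistance (c N) n m - (real m - real n)\<bar>)"
          using that \<open>finite ?P\<close> cSUP_upper[of "(n, m)" ?P
            "\<lambda>(n, m). \<bar>resistance (c N) n m - (real m - real n)\<bar>"] by simp
        also have "\<dots> \<le> real N * e" using elim by (simp add: field_simps)
        finally show ?thesis .
      qed
      have small: "(3 / N + 25 * e) * exp 50 < sin d / 5"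
        using elim(1) e_small by (simp add: distrib_right)
      note close = gap_close[OF elim(3) _ _ less_imp_le[OF e(1)] e(2) d(1,2) small]
      have gap: "\<bar>sqrt ((real N)\<^sup>2 * spectral_gap N (c N)) - \<bar>2 * real N * sin (pi / N / 2)\<bar>\<bar>
          \<le> 10 * d"
        by (rule close(1)) (use pos elim(3) res' in auto)
      have val: "\<bar>gap_eigenfunction N (c N) x - cos_profile N x\<bar> \<le> 10 * d"
        if "x \<in> {1..N}" for x
        by (rule close(2)) (use pos elim(3) res' that in auto)
      have flux: "\<bar>real N * cgrad N (c N) (gap_eigenfunction N (c N)) x
          - real N * cgrad N (\<lambda>_. 1) (cos_profile N) x\<bar> \<le> 10 * d" if "x \<in> {1..N}" for x
        by (rule close(3)) (use pos elim(3) res' that in auto)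
      have ne: "finite {1..N}" "{1..N} \<noteq> {}" using elim by auto
      have sup_val: "\<bar>SUP x \<in> {1..N}. \<bar>gap_eigenfunction N (c N) x - cos_profile N x\<bar>\<bar> \<le> 10 * d"
        by (rule abs_SUP_abs_le[OF ne]) (rule val)
      have sup_flux: "\<bar>SUP x \<in> {1..N}. \<bar>real N * cgrad N (c N) (gap_eigenfunction N (c N)) x
          - real N * cgrad N (\<lambda>_. 1) (cos_profile N) x\<bar>\<bar> \<le> 10 * d"
        by (rule abs_SUP_abs_le[OF ne]) (rule flux)
      show ?case
        using le_less_trans[OF gap d(3)] le_less_trans[OF sup_val d(3)]
          le_less_trans[OF sup_flux d(3)] by (intro conjI)
    qed
  qed
  have "(\<lambda>N. SUP x \<in> {1..N}. \<bar>gap_eigenfunction N (c N) x - cos_profile N x\<bar>) \<longlonglongrightarrow> 0"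
  proof (rule tendstoI)
    fix r :: real assume "0 < r"
    from est[OF this] show "\<forall>\<^sub>F N in sequentially.
        dist (SUP x \<in> {1..N}. \<bar>gap_eigenfunction N (c N) x - cos_profile N x\<bar>) 0 < r"
      by (rule eventually_mono) (simp add: dist_real_def)
  qed
  moreover have "(\<lambda>N. SUP x \<in> {1..N}.
            \<bar>real N * cgrad N (c N) (gap_eigenfunction N (c N)) x
             - real N * cgrad N (\<lambda>_. 1) (cos_profile N) x\<bar>) \<longlonglongrightarrow> 0"
  proof (rule tendstoI)
    fix r :: real assume "0 < r"
    from est[OF this] show "\<forall>\<^sub>F N in sequentially. dist (SUP x \<in> {1..N}.
            \<bar>real N * cgrad N (c N) (gap_eigenfunction N (c N)) x
             - real N * cgrad N (\<lambda>_. 1) (cos_profile N) x\<bar>) 0 < r"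
      by (rule eventually_mono) (simp add: dist_real_def)
  qed
  moreover have "(\<lambda>N. (real N)\<^sup>2 * spectral_gap N (c N) / pi\<^sup>2) \<longlonglongrightarrow> 1"
  proof -
    define T where "T = (\<lambda>N. sqrt ((real N)\<^sup>2 * spectral_gap N (c N)))"
    define P where "P = (\<lambda>N. \<bar>2 * real N * sin (pi / N / 2)\<bar>)"
    have "(\<lambda>N. T N - P N) \<longlonglongrightarrow> 0"
    proof (rule tendstoI)
      fix r :: real assume "0 < r"
      from est[OF this] show "\<forall>\<^sub>F N in sequentially. dist (T N - P N) 0 < r"
        by (rule eventually_mono) (simp add: dist_real_def T_def P_def)
    qed
    moreover have "P \<longlonglongrightarrow> \<bar>pi\<bar>"
      unfolding P_def by (intro tendsto_rabs) real_asymp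
    ultimately have "T \<longlonglongrightarrow> \<bar>pi\<bar>"
      using tendsto_add[of "\<lambda>N. T N - P N" 0 sequentially P "\<bar>pi\<bar>"] by simp
    then have "(\<lambda>N. (T N)\<^sup>2 / pi\<^sup>2) \<longlonglongrightarrow> \<bar>pi\<bar>\<^sup>2 / pi\<^sup>2"
      by (intro tendsto_intros) auto
    \<comment> \<open>Squaring undoes \<open>sqrt\<close> only for nonnegative arguments. Positivity
      holds eventually because \<open>T\<close> tends to \<open>pi\<close> and \<open>sqrt\<close>
      preserves signs.\<close>
    moreover have "\<forall>\<^sub>F N in sequentially.
        (T N)\<^sup>2 / pi\<^sup>2 = (real N)\<^sup>2 * spectral_gap N (c N) / pi\<^sup>2"
    proof -
      have "\<forall>\<^sub>F N in sequentially. 0 < T N"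
        using \<open>T \<longlonglongrightarrow> \<bar>pi\<bar>\<close> by (rule order_tendstoD(1)) simp
      then show ?thesis
      proof eventually_elim
        case (elim N)
        then have "0 < (real N)\<^sup>2 * spectral_gap N (c N)"
          unfolding T_def by (simp only: real_sqrt_gt_0_iff)
        then show ?case unfolding T_def by (simp only: real_sqrt_pow2 less_imp_le)
      qed
    qed
    ultimately have "(\<lambda>N. (real N)\<^sup>2 * spectral_gap N (c N) / pi\<^sup>2) \<longlonglongrightarrow> \<bar>pi\<bar>\<^sup>2 / pi\<^sup>2"
      by (rule Lim_transform_eventually)
    then show ?thesis by simp
  qed
  ultimately show ?thesis by blast
qed

end
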